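(* Let $\beta,\gamma,p,n$ be positive integers with $1\leqslant\gamma\leqslant\beta$. Then the number of spanning trees $\tau(\overrightarrow{C}^{p,\gamma n+p}_{\beta n})$ of the directed circulant graph $\overrightarrow{C}^{p,\gamma n+p}_{\beta n}$ satisfies the following. (i) If $\beta$ is odd and $(p,n)=1$, then $$\tau(\overrightarrow{C}^{p,\gamma n+p}_{\beta n})=n2^{\beta n-1}\prod_{k=1}^{(\beta-1)/2}\Big(1-2\cos(2\pi(p+\gamma n/2)k/\beta)\cos^n(\pi\gamma k/\beta)+\cos^{2n}(\pi\gamma k/\beta)\Big).$$ (ii) If $\beta$ is even, $(p,n)=1$, and $\gamma$ or $p$ is odd, then $$\tau(\overrightarrow{C}^{p,\gamma n+p}_{\beta n})=n2^{\beta n-1+\delta_{\gamma\text{ even}}}\prod_{k=1}^{\beta/2-1}\Big(1-2\cos(2\pi(p+\gamma n/2)k/\beta)\cos^n(\pi\gamma k/\beta)+\cos^{2n}(\pi\gamma k/\beta)\Big).$$ (iii) $\tau(\overrightarrow{C}^{p,\gamma n+p}_{\beta n})=0$ if either $(p,n)=1$ and $\beta$, $p$ and $\gamma$ are all even, or $(p,n)\neq1$.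
   Context: For positive integers $N$ and $g_1,\ldots,g_d$, the directed circulant graph $\overrightarrow{C}^{g_1,\ldots,g_d}_N$ is the directed graph with vertex set $\mathbb{Z}/N\mathbb{Z}$ having, for each vertex $v$ and each $m\in\{1,\ldots,d\}$, one oriented edge from $v$ to $v+g_m \bmod N$. Generators are listed with multiplicity: if some $g_m$ coincide modulo $N$ the corresponding parallel edges are counted as distinct, and the out-degree of each vertex is $d$. A spanning arborescence converging to a vertex $v$ of a directed graph $G$ is a connected spanning oriented subgraph (an oriented tree) in which every vertex other than $v$ has out-degree one and $v$ has out-degree zero; $\tau^-(G,v)$ is the number of these. Equivalently, by the Tutte matrix tree theorem, $\tau^-(G,v)$ is the determinant of the matrix obtained by deleting the row and column of $v$ from the Laplacian $\Delta_G^-=D^--A$, where $D^-$ is the diagonal matrix of out-degrees and $A_{ij}$ is the number of edges from $i$ to $j$. For a regular directed graph $G$, the number of spanning trees is defined as $\tau(G)=\sum_{v\in V(G)}\tau^-(G,v)$ (sum over all roots). Notation: $(p,n)$ is the greatest common divisor; empty products equal $1$; $\delta_A=1$ if the statement $A$ holds and $0$ otherwise. *)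

theory Defs
  imports Complex_Main "Graph_Theory.Digraph_Component"
begin

text \<open>
  The vertices are the representatives \<open>0, \<dots>, N - 1\<close> of the residue classes modulo \<open>N\<close>. The arc
  \<open>(v, m)\<close> leaves \<open>v\<close> along the generator with (0-based) index \<open>m\<close>, so generators that coincide
  modulo \<open>N\<close> give distinct parallel arcs, and a generator divisible by \<open>N\<close> gives loops.
\<close>

definition circulant_digraph :: "nat \<Rightarrow> nat list \<Rightarrow> (nat, nat \<times> nat) pre_digraph" where
  "circulant_digraph N gs =
     \<lparr>verts = {..<N},
      arcs = {..<N} \<times> {..<length gs},
      tail = fst,
      head = (\<lambda>(v, m). (v + gs ! m) mod N)\<rparr>"

lemma fin_digraph_circulant_digraph: "fin_digraph (circulant_digraph N gs)"
  by unfold_locales (auto simp: circulant_digraph_def)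

lemma out_degree_circulant_digraph:
  assumes "v \<in> verts (circulant_digraph N gs)"
  shows "out_degree (circulant_digraph N gs) v = length gs"
proof -
  have "out_arcs (circulant_digraph N gs) v = {v} \<times> {..<length gs}"
    using assms by (auto simp: circulant_digraph_def out_arcs_def)
  then show ?thesis
    by (simp add: out_degree_def)
qed

text \<open>
  The library's \<^const>\<open>spanning_tree\<close> asks for connectedness of the underlying undirected graph, but
  excludes directed cycles only. Together with the out-degree condition this yields oriented trees:
  \<open>H\<close> has exactly one arc less than it has vertices. As a subgraph, \<open>H\<close> inherits the
  functions \<^const>\<open>tail\<close> and \<^const>\<open>head\<close> of \<open>G\<close>, so it is determined by its sets of vertices and arcs.
\<close>

definition spanning_arborescence ::
    "('a, 'b) pre_digraph \<Rightarrow> ('a, 'b) pre_digraph \<Rightarrow> 'a \<Rightarrow> bool" where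
  "spanning_arborescence H G v \<longleftrightarrow>
     spanning_tree H G \<and> v \<in> verts G \<and>
     (\<forall>u \<in> verts G. out_degree H u = (if u = v then 0 else 1))"

definition num_arborescences :: "('a, 'b) pre_digraph \<Rightarrow> 'a \<Rightarrow> nat" where
  "num_arborescences G v = card {H. spanning_arborescence H G v}"

definition num_spanning_trees :: "('a, 'b) pre_digraph \<Rightarrow> nat" where
  "num_spanning_trees G = (\<Sum>v\<in>verts G. num_arborescences G v)"

end

theory Submission
  imports
    Defs
    "Jordan_Normal_Form.Determinant"
    "HOL-Computational_Algebra.Fundamental_Theorem_Algebra"
    "HOL-Number_Theory.Cong"
begin

text \<open>
  Expanding \<open>det (x + L)\<close>, for the Laplacian \<open>L\<close>, along the rows gives one term \<open>x ^ r\<close> for every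
  spanning forest with \<open>r\<close> roots whose trees are directed towards the roots; hence the derivative at
  \<open>x = 0\<close> counts the spanning arborescences over all roots. For a circulant digraph on \<open>N\<close> vertices
  the characters of the cyclic group diagonalise \<open>L\<close>, and the determinant is a product over the
  characters \<open>j < N\<close>. With \<open>N = \<beta> * n\<close> and generators \<open>p\<close>, \<open>\<gamma> * n + p\<close>, grouping the indices \<open>j\<close> modulo
  \<open>\<beta>\<close> and using \<open>\<Prod> (y - c z) = y ^ n - c ^ n\<close> over the \<open>n\<close>-th roots of unity \<open>z\<close> leaves \<open>\<beta>\<close>
  factors when \<open>p\<close> and \<open>n\<close> are coprime; the factors of \<open>k\<close> and \<open>\<beta> - k\<close> are complex conjugates, and for even
  \<open>\<beta>\<close> the self-conjugate factor \<open>k = \<beta> / 2\<close> carries the parity conditions. If \<open>p\<close> and \<open>n\<close> are not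
  coprime, two factors vanish at \<open>x = 0\<close>, and so does the derivative.
\<close>

section \<open>The matrix tree theorem\<close>

text \<open>Connectedness only yields an undirected path, so the induction follows such a path away
  from \<open>v\<close>. An arc traversed backwards extends the directed path at hand; an arc
  traversed forwards is the only one leaving its tail, so the directed path from that tail to
  \<open>v\<close> already starts with it.\<close>

lemma arborescence_reaches_root:
  assumes conn: "connected H" and out: "\<forall>u \<in> verts H. out_degree H u = (if u = v then 0 else 1)"
    and wf: "wf_digraph H" and fin: "finite (arcs H)" and v: "v \<in> verts H" and u: "u \<in> verts H"
  shows "u \<rightarrow>\<^sup>*\<^bsub>H\<^esub> v"
proof -
  interpret wf_digraph H by (rule wf)
  have uniq: "a = b" if "a \<in> arcs H" "b \<in> arcs H" "tail H a = tail H b" for a b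
  proof -
    have "card (out_arcs H (tail H a)) \<le> 1"
      using out that(1) by (auto simp: out_degree_def)
    moreover have "finite (out_arcs H (tail H a))"
      using fin by (auto simp: out_arcs_def)
    ultimately show ?thesis
      using that card_le_Suc0_iff_eq[of "out_arcs H (tail H a)"] by auto
  qed
  have sink: "tail H a \<noteq> v" if "a \<in> arcs H" for a
  proof
    assume "tail H a = v"
    moreover have "card (out_arcs H v) = 0" using out v by (auto simp: out_degree_def)
    moreover have "finite (out_arcs H v)" using fin by (auto simp: out_arcs_def)
    ultimately show False using that by auto
  qed
  have "v \<rightarrow>\<^sup>*\<^bsub>with_proj (mk_symmetric H)\<^esub> u"
    using conn u v by (auto simp: connected_def strongly_connected_def mk_symmetric_def)
  then have "(v, u) \<in> (parcs (mk_symmetric H))\<^sup>*"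
    by (auto dest!: reachable_rtranclI simp: arcs_ends_conv)
  then show ?thesis
  proof induction
    case base
    then show ?case using v by auto
  next
    case (step y z)
    then obtain a where a: "a \<in> arcs H"
      and "(tail H a = y \<and> head H a = z) \<or> (head H a = y \<and> tail H a = z)"
      by (auto simp: mk_symmetric_def)
    then show ?case
    proof (elim disjE conjE)
      assume yz: "tail H a = y" "head H a = z"
      from step.IH show ?case
      proof (cases rule: converse_reachable_cases)
        case base
        then show ?thesis using sink[OF a] yz by auto
      next
        case (step w)
        then obtain b where "b \<in> arcs H" "tail H b = y" "head H b = w" by auto
        with uniq[OF a this(1)] yz step show ?thesis by auto
      qed
    next
      assume "head H a = y" "tail H a = z"
      then have "z \<rightarrow>\<^bsub>H\<^esub> y" using a by (auto simp: arcs_ends_conv)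
      then show ?case using step.IH by (rule adj_reachable_trans)
    qed
  qed
qed

lemma connected_if_reaches_root:
  assumes "wf_digraph H" and "v \<in> verts H" and reach: "\<And>u. u \<in> verts H \<Longrightarrow> u \<rightarrow>\<^sup>*\<^bsub>H\<^esub> v"
  shows "connected H"
proof -
  interpret wf_digraph H by fact
  interpret S: pair_wf_digraph "mk_symmetric H" by (rule wellformed_mk_symmetric)
  have r: "u \<rightarrow>\<^sup>*\<^bsub>with_proj (mk_symmetric H)\<^esub> v" if "u \<in> verts H" for u
    using reach[OF that] by (rule reachable_mk_symmetricI)
  have "u \<rightarrow>\<^sup>*\<^bsub>with_proj (mk_symmetric H)\<^esub> w" if "u \<in> verts H" "w \<in> verts H" for u w
    using S.reachable_trans[OF r[OF that(1)] symmetric_reachable[OF symmetric_mk_symmetric r[OF that(2)]]] .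
  then show ?thesis
    using assms(2) by (auto simp: connected_def strongly_connected_def)
qed

text \<open>Since arcs are determined by their tails, a directed cycle cannot be left: whatever is
  reachable from it lies on a cycle too. The sink \<open>v\<close> would then lie on one, yet no arc
  leaves it.\<close>

lemma forest_if_reaches_sink:
  assumes wf: "wf_digraph H" and reach: "\<And>u. u \<in> verts H \<Longrightarrow> u \<rightarrow>\<^sup>*\<^bsub>H\<^esub> v"
    and uniq: "\<And>a b. a \<in> arcs H \<Longrightarrow> b \<in> arcs H \<Longrightarrow> tail H a = tail H b \<Longrightarrow> a = b"
    and sink: "\<And>a. a \<in> arcs H \<Longrightarrow> tail H a \<noteq> v"
  shows "forest H"
proof -
  interpret wf_digraph H by fact
  have cyc: "w \<rightarrow>\<^sup>+\<^bsub>H\<^esub> w" if "u \<rightarrow>\<^sup>*\<^bsub>H\<^esub> w" "u \<rightarrow>\<^sup>+\<^bsub>H\<^esub> u" for u w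
    using that
  proof (induction rule: reachable_induct)
    case (step x y)
    from step.IH[OF step.prems] obtain z where z: "x \<rightarrow>\<^bsub>H\<^esub> z" "(z, x) \<in> (arcs_ends H)\<^sup>*"
      by (metis tranclD)
    have "z = y" using z(1) step.hyps(2) uniq by (auto simp: arcs_ends_conv)
    then show ?case using z step.hyps(2) by (metis rtrancl_into_trancl1)
  qed auto
  show ?thesis
    unfolding forest_def
  proof
    assume "\<exists>p. cycle p"
    then obtain u where u: "u \<rightarrow>\<^sup>+\<^bsub>H\<^esub> u" unfolding cycle_def using reachable1_awalk by blast
    then have "v \<rightarrow>\<^sup>+\<^bsub>H\<^esub> v" using cyc reach reachable1_in_verts(1) by blast
    then obtain z where "v \<rightarrow>\<^bsub>H\<^esub> z" by (meson tranclD)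
    then show False using sink by (auto simp: arcs_ends_conv)
  qed
qed

text \<open>A subgraph in which every vertex has at most one outgoing arc is encoded by the choice, at each
  vertex, of that arc, or of \<^term>\<open>None\<close> at the roots.\<close>

definition arc_choices :: "('a, 'b) pre_digraph \<Rightarrow> ('a \<Rightarrow> 'b option) set" where
  "arc_choices G = (\<Pi>\<^sub>E i\<in>verts G. insert None (Some ` out_arcs G i))"

definition choice_subgraph :: "('a, 'b) pre_digraph \<Rightarrow> ('a \<Rightarrow> 'b option) \<Rightarrow> ('a, 'b) pre_digraph" where
  "choice_subgraph G g = G\<lparr>arcs := {a. \<exists>i\<in>verts G. g i = Some a}\<rparr>"

definition choice_roots :: "('a, 'b) pre_digraph \<Rightarrow> ('a \<Rightarrow> 'b option) \<Rightarrow> 'a set" where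
  "choice_roots G g = {i \<in> verts G. g i = None}"

text \<open>This excludes cycles without naming them: in a finite digraph, following the choices
  from a vertex either stops at a root or runs into a cycle.\<close>

definition rooted_forest_choice :: "('a, 'b) pre_digraph \<Rightarrow> ('a \<Rightarrow> 'b option) \<Rightarrow> bool" where
  "rooted_forest_choice G g \<longleftrightarrow>
     (\<forall>u\<in>verts G. \<exists>r\<in>choice_roots G g. u \<rightarrow>\<^sup>*\<^bsub>choice_subgraph G g\<^esub> r)"

lemma choice_subgraph_simps [simp]:
  "verts (choice_subgraph G g) = verts G"
  "tail (choice_subgraph G g) = tail G"
  "head (choice_subgraph G g) = head G"
  "arcs (choice_subgraph G g) = {a. \<exists>i\<in>verts G. g i = Some a}"
  by (simp_all add: choice_subgraph_def)

lemma arc_choices_SomeD: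
  assumes "g \<in> arc_choices G" "i \<in> verts G" "g i = Some a"
  shows "a \<in> arcs G" "tail G a = i"
proof -
  have "g i \<in> insert None (Some ` out_arcs G i)"
    using assms(1,2) unfolding arc_choices_def by (rule PiE_mem)
  then show "a \<in> arcs G" "tail G a = i" using assms(3) by auto
qed

context fin_digraph
begin

lemma finite_arc_choices: "finite (arc_choices G)"
  unfolding arc_choices_def by (intro finite_PiE) auto

lemma wf_choice_subgraph: "g \<in> arc_choices G \<Longrightarrow> wf_digraph (choice_subgraph G g)"
proof
  fix a assume g: "g \<in> arc_choices G" and "a \<in> arcs (choice_subgraph G g)"
  then obtain i where "i \<in> verts G" "g i = Some a" by auto
  then have "a \<in> arcs G" by (rule arc_choices_SomeD(1)[OF g])
  then show "tail (choice_subgraph G g) a \<in> verts (choice_subgraph G g)"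
    "head (choice_subgraph G g) a \<in> verts (choice_subgraph G g)" by simp_all
qed

lemma dominates_choice_subgraph:
  assumes "g \<in> arc_choices G"
  shows "i \<rightarrow>\<^bsub>choice_subgraph G g\<^esub> j \<longleftrightarrow> i \<in> verts G \<and> (\<exists>a. g i = Some a \<and> head G a = j)"
proof
  assume "i \<rightarrow>\<^bsub>choice_subgraph G g\<^esub> j"
  then obtain a where "a \<in> arcs (choice_subgraph G g)" "tail G a = i" "head G a = j"
    by (auto simp: arcs_ends_conv)
  then obtain k where "k \<in> verts G" "g k = Some a" by auto
  moreover from this have "k = i" using arc_choices_SomeD(2)[OF assms, of k a] \<open>tail G a = i\<close> by simp
  ultimately show "i \<in> verts G \<and> (\<exists>a. g i = Some a \<and> head G a = j)"
    using \<open>head G a = j\<close> by blast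
next
  assume "i \<in> verts G \<and> (\<exists>a. g i = Some a \<and> head G a = j)"
  then obtain a where a: "i \<in> verts G" "g i = Some a" "head G a = j" by blast
  then have "a \<in> arcs (choice_subgraph G g)" "tail G a = i"
    using arc_choices_SomeD(2)[OF assms a(1,2)] by auto
  then show "i \<rightarrow>\<^bsub>choice_subgraph G g\<^esub> j"
    using a(3) by (force simp: arcs_ends_conv)
qed

lemma out_arcs_choice_subgraph:
  assumes "g \<in> arc_choices G" "i \<in> verts G"
  shows "out_arcs (choice_subgraph G g) i = set_option (g i)"
proof (rule Set.set_eqI)
  fix a
  show "a \<in> out_arcs (choice_subgraph G g) i \<longleftrightarrow> a \<in> set_option (g i)"
    using arc_choices_SomeD(2)[OF assms(1), of _ a] assms(2) by (simp, metis)
qed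

lemma choice_subgraph_spanning_arborescence:
  assumes g: "g \<in> arc_choices G" and forest: "rooted_forest_choice G g"
    and root: "choice_roots G g = {v}"
  shows "spanning_arborescence (choice_subgraph G g) G v"
proof -
  let ?H = "choice_subgraph G g"
  have v: "v \<in> verts G" "g v = None" and Some: "\<And>u. u \<in> verts G \<Longrightarrow> u \<noteq> v \<Longrightarrow> g u \<noteq> None"
    using root by (auto simp: choice_roots_def)
  have wf: "wf_digraph ?H" by (rule wf_choice_subgraph[OF g])
  have reach: "u \<rightarrow>\<^sup>*\<^bsub>?H\<^esub> v" if "u \<in> verts ?H" for u
    using forest that root by (simp add: rooted_forest_choice_def)
  have "connected ?H"
    using wf _ reach by (rule connected_if_reaches_root) (simp add: v)
  moreover have "forest ?H"
  proof (rule forest_if_reaches_sink[OF wf reach])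
    show "a = b" if ab: "a \<in> arcs ?H" "b \<in> arcs ?H" "tail ?H a = tail ?H b" for a b
    proof -
      obtain i j where "i \<in> verts G" "g i = Some a" "j \<in> verts G" "g j = Some b"
        using ab(1,2) by auto
      moreover from this have "tail G a = i" "tail G b = j"
        by (simp_all add: arc_choices_SomeD(2)[OF g])
      ultimately show ?thesis using ab(3) by simp
    qed
    show "tail ?H a \<noteq> v" if a: "a \<in> arcs ?H" for a
    proof -
      obtain i where "i \<in> verts G" "g i = Some a"
        using a by auto
      moreover from this have "tail G a = i" by (rule arc_choices_SomeD(2)[OF g])
      ultimately show ?thesis using v by auto
    qed
  qed auto
  moreover have "spanning ?H G"
    using wf wf_digraph arc_choices_SomeD(1)[OF g]
    by (auto simp: spanning_def subgraph_def compatible_def)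
  moreover have "out_degree ?H u = (if u = v then 0 else 1)" if "u \<in> verts G" for u
    using v Some[OF that] by (auto simp: out_degree_def out_arcs_choice_subgraph[OF g that])
  ultimately show ?thesis
    using v by (auto simp: spanning_arborescence_def spanning_tree_def tree_def)
qed

lemma spanning_arborescence_choice:
  assumes "spanning_arborescence H G v"
  obtains g where "g \<in> arc_choices G" "rooted_forest_choice G g" "choice_roots G g = {v}"
    "choice_subgraph G g = H"
proof -
  note H = assms[unfolded spanning_arborescence_def spanning_tree_def tree_def spanning_def]
  have v: "v \<in> verts G" and conn: "connected H" and sub: "subgraph H G" and verts: "verts G = verts H"
    and out: "\<forall>u\<in>verts G. out_degree H u = (if u = v then 0 else 1)"
    using H by - (elim conjE, assumption)+
  have wf: "wf_digraph H" and arcs: "arcs H \<subseteq> arcs G" and th: "tail G = tail H" "head G = head H"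
    using sub[unfolded subgraph_def compatible_def] by - (elim conjE, assumption)+
  have fin: "finite (arcs H)" using arcs finite_arcs by (rule finite_subset)
  \<comment> \<open>\<open>the_elem\<close> is meaningful because the out-degree is \<open>1\<close>
    away from \<open>v\<close>; restricting to \<open>verts G\<close> makes \<open>g\<close>
    extensional.\<close>
  define g where "g = (\<lambda>i\<in>verts G. if i = v then None else Some (the_elem (out_arcs H i)))"
  have single: "\<exists>b. out_arcs H i = {b}" if "i \<in> verts G" "i \<noteq> v" for i
    using that out by (auto simp: out_degree_def card_1_singleton_iff)
  \<comment> \<open>Cardinality \<open>0\<close> would also fit an infinite set, so emptiness rests
    on the finiteness of the arcs.\<close>
  have "card (out_arcs H v) = 0"
    using out v by (simp add: out_degree_def)
  then have empty: "out_arcs H v = {}"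
    using fin by (simp add: out_arcs_def)
  have sets: "set_option (g i) = out_arcs H i" if i: "i \<in> verts G" for i
  proof (cases "i = v")
    case True
    then show ?thesis using i empty by (simp add: g_def)
  next
    case False
    then obtain b where "out_arcs H i = {b}" using single i by blast
    then show ?thesis using i False by (simp add: g_def)
  qed
  have "the_elem (out_arcs H i) \<in> out_arcs G i" if i: "i \<in> verts G" "i \<noteq> v" for i
  proof -
    obtain b where b: "out_arcs H i = {b}" using single[OF i] by blast
    then have "b \<in> arcs H" "tail H b = i" by (auto simp: set_eq_iff)
    then show ?thesis using b arcs th by auto
  qed
  then have g: "g \<in> arc_choices G"
    by (auto simp: arc_choices_def g_def)
  have "arcs H = (\<Union>i\<in>verts H. out_arcs H i)"
    using wf_digraph.tail_in_verts[OF wf] by auto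
  also have "\<dots> = (\<Union>i\<in>verts G. set_option (g i))"
    using sets verts by simp
  also have "\<dots> = {a. \<exists>i\<in>verts G. g i = Some a}"
    by auto
  finally have "arcs (choice_subgraph G g) = arcs H" by simp
  then have H: "choice_subgraph G g = H"
    by (intro pre_digraph.equality) (simp_all add: verts th)
  have root: "choice_roots G g = {v}"
    using v by (auto simp: choice_roots_def g_def)
  have "u \<rightarrow>\<^sup>*\<^bsub>choice_subgraph G g\<^esub> v" if "u \<in> verts G" for u
    unfolding H
    by (rule arborescence_reaches_root[OF conn _ wf fin]) (use out v verts that in simp_all)
  then have "rooted_forest_choice G g"
    by (simp add: rooted_forest_choice_def root)
  with g H root show thesis by (intro that)
qed

text \<open>\<open>choice_subgraph\<close> is a bijection between the two sets: the outgoing arcs at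
  each vertex give the choice back.\<close>

lemma num_arborescences_eq_card_choices:
  "num_arborescences G v =
     card {g \<in> arc_choices G. rooted_forest_choice G g \<and> choice_roots G g = {v}}"
  (is "_ = card ?C")
proof -
  have "inj_on (choice_subgraph G) (arc_choices G)"
  proof (rule inj_onI)
    fix g h assume gh: "g \<in> arc_choices G" "h \<in> arc_choices G"
      and eq: "choice_subgraph G g = choice_subgraph G h"
    show "g = h"
    proof (rule PiE_ext)
      show "g \<in> (\<Pi>\<^sub>E i\<in>verts G. insert None (Some ` out_arcs G i))"
        "h \<in> (\<Pi>\<^sub>E i\<in>verts G. insert None (Some ` out_arcs G i))"
        using gh by (auto simp: arc_choices_def)
      show "g i = h i" if "i \<in> verts G" for i
      proof -
        have "set_option (g i) = set_option (h i)"
          using out_arcs_choice_subgraph[OF gh(1) that] out_arcs_choice_subgraph[OF gh(2) that] eq by simp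
        then show ?thesis by (cases "g i"; cases "h i") auto
      qed
    qed
  qed
  then have "card ?C = card (choice_subgraph G ` ?C)"
    by (intro card_image[symmetric]) (rule inj_on_subset, auto)
  also have "choice_subgraph G ` ?C = {H. spanning_arborescence H G v}"
  proof (intro subset_antisym subsetI)
    fix H assume "H \<in> {H. spanning_arborescence H G v}"
    then obtain g where "g \<in> arc_choices G" "rooted_forest_choice G g" "choice_roots G g = {v}"
      "choice_subgraph G g = H" using spanning_arborescence_choice by blast
    then show "H \<in> choice_subgraph G ` ?C" by blast
  next
    fix H assume "H \<in> choice_subgraph G ` ?C"
    then show "H \<in> {H. spanning_arborescence H G v}"
      using choice_subgraph_spanning_arborescence by blast
  qed
  finally show ?thesis by (simp add: num_arborescences_def)
qed

end

section \<open>Determinants of single choices\<close>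

text \<open>The share of one choice in row \<open>i\<close> of the shifted Laplacian. For a choice
  function, these rows form the Laplacian of its subgraph with \<open>x\<close> added on the
  diagonal at the roots; a chosen loop gives a zero row.\<close>

definition choice_row :: "('a, 'b) pre_digraph \<Rightarrow> 'c::comm_ring_1 \<Rightarrow> 'b option \<Rightarrow> 'a \<Rightarrow> 'a \<Rightarrow> 'c" where
  "choice_row G x c i j =
     (case c of None \<Rightarrow> x * of_bool (i = j) | Some a \<Rightarrow> of_bool (i = j) - of_bool (head G a = j))"

lemma det_choice_rooted_forest:
  fixes x :: "'c::comm_ring_1"
  assumes "fin_digraph G" and verts: "verts G = {..<N}"
    and g: "g \<in> arc_choices G" and forest: "rooted_forest_choice G g"
  shows "det (mat N N (\<lambda>(i, j). choice_row G x (g i) i j)) = x ^ card (choice_roots G g)"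
proof -
  interpret fin_digraph G by fact
  interpret H: wf_digraph "choice_subgraph G g" by (rule wf_choice_subgraph[OF g])
  let ?t = "\<lambda>\<sigma>. signof \<sigma> * (\<Prod>i = 0..<N. choice_row G x (g i) i (\<sigma> i))"
  \<comment> \<open>A permutation with a nonzero Leibniz term sends each vertex to itself or to the head of its chosen
    arc; by injectivity it fixes whatever points to a fixed vertex, starting from the roots.\<close>
  have fixed: "\<sigma> i = i"
    if \<sigma>: "\<sigma> permutes {0..<N}" and nz: "\<And>i. i < N \<Longrightarrow> choice_row G x (g i) i (\<sigma> i) \<noteq> 0"
      and r: "r \<in> choice_roots G g" "i \<rightarrow>\<^sup>*\<^bsub>choice_subgraph G g\<^esub> r" for \<sigma> i r
    using r(2)
  proof (induction rule: H.converse_reachable_induct)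
    case base
    have "r < N" "g r = None" using r(1) verts by (simp_all add: choice_roots_def)
    then show ?case
      using nz[of r] by (cases "r = \<sigma> r") (simp_all add: choice_row_def)
  next
    case (step i j)
    then obtain a where a: "i < N" "g i = Some a" "head G a = j"
      using verts by (auto simp: dominates_choice_subgraph[OF g])
    then have "\<sigma> i = i \<or> \<sigma> i = j"
      using nz[OF a(1)] by (cases "i = \<sigma> i"; cases "j = \<sigma> i") (simp_all add: choice_row_def)
    then show ?case using step.IH permutes_inj[OF \<sigma>] by (metis injD)
  qed
  \<comment> \<open>A vertex whose chosen arc is a loop reaches only itself and is no root. Hence
    the diagonal entries off the roots are \<open>1\<close>.\<close>
  have loopfree: "head G a \<noteq> i" if a: "i < N" "g i = Some a" for i a
  proof
    assume loop: "head G a = i"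
    obtain r where r: "r \<in> choice_roots G g" "i \<rightarrow>\<^sup>*\<^bsub>choice_subgraph G g\<^esub> r"
      using forest a verts by (auto simp: rooted_forest_choice_def)
    from r(2) have "r = i"
      by (induction rule: H.reachable_induct)
        (use a loop in \<open>auto simp: dominates_choice_subgraph[OF g]\<close>)
    then show False using r(1) a by (simp add: choice_roots_def)
  qed
  have "det (mat N N (\<lambda>(i, j). choice_row G x (g i) i j)) = (\<Sum>\<sigma> | \<sigma> permutes {0..<N}. ?t \<sigma>)"
    by (subst det_def'[of _ N]) (auto intro!: sum.cong prod.cong simp: permutes_in_image)
  also have "\<dots> = (\<Sum>\<sigma>\<in>{id}. ?t \<sigma>)"
  proof (rule sum.mono_neutral_right)
    show "finite {\<sigma>. \<sigma> permutes {0..<N}}" by (simp add: finite_permutations)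
    show "\<forall>\<sigma>\<in>{\<sigma>. \<sigma> permutes {0..<N}} - {id}. ?t \<sigma> = 0"
    proof (rule ballI, rule ccontr)
      fix \<sigma> assume \<sigma>: "\<sigma> \<in> {\<sigma>. \<sigma> permutes {0..<N}} - {id}" and "?t \<sigma> \<noteq> 0"
      then have nz: "choice_row G x (g i) i (\<sigma> i) \<noteq> 0" if "i < N" for i
        using that prod_zero[of "{0..<N}" "\<lambda>i. choice_row G x (g i) i (\<sigma> i)"] by fastforce
      have "\<sigma> i = i" for i
      proof (cases "i < N")
        case True
        then obtain r where "r \<in> choice_roots G g" "i \<rightarrow>\<^sup>*\<^bsub>choice_subgraph G g\<^esub> r"
          using forest verts by (auto simp: rooted_forest_choice_def)
        with fixed nz \<sigma> show ?thesis by blast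
      next
        case False
        then show ?thesis using \<sigma> by (auto simp: permutes_def)
      qed
      then show False using \<sigma> by auto
    qed
  qed (simp add: permutes_id)
  also have "\<dots> = (\<Prod>i = 0..<N. if g i = None then x else 1)"
    using loopfree by (auto simp: signof_id choice_row_def intro!: prod.cong split: option.splits)
  also have "\<dots> = x ^ card {i \<in> {0..<N}. g i = None}"
    by (simp add: prod.If_cases Int_def)
  finally show ?thesis
    using verts by (simp add: choice_roots_def)
qed

lemma det_choice_not_rooted_forest:
  fixes x :: "'c::field"
  assumes "fin_digraph G" and verts: "verts G = {..<N}"
    and g: "g \<in> arc_choices G" and not_forest: "\<not> rooted_forest_choice G g"
  shows "det (mat N N (\<lambda>(i, j). choice_row G x (g i) i j)) = 0"
proof -
  interpret fin_digraph G by fact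
  interpret H: wf_digraph "choice_subgraph G g" by (rule wf_choice_subgraph[OF g])
  \<comment> \<open>The indicator vector of the vertices that reach no root lies in the kernel.\<close>
  define S where "S = {i \<in> verts G. \<not> (\<exists>r\<in>choice_roots G g. i \<rightarrow>\<^sup>*\<^bsub>choice_subgraph G g\<^esub> r)}"
  let ?v = "vec N (\<lambda>i. of_bool (i \<in> S)) :: 'c vec"
  let ?M = "mat N N (\<lambda>(i, j). choice_row G x (g i) i j)"
  \<comment> \<open>A vertex with a chosen arc reaches a root exactly when the head of that arc
    does, so the two terms of its row cancel against the indicator of \<open>S\<close>.\<close>
  have S_head: "head G a \<in> S \<longleftrightarrow> i \<in> S" if "i < N" "g i = Some a" for i a
  proof -
    have i: "i \<rightarrow>\<^bsub>choice_subgraph G g\<^esub> head G a"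
      using that verts by (auto simp: dominates_choice_subgraph[OF g])
    have "i \<rightarrow>\<^sup>*\<^bsub>choice_subgraph G g\<^esub> r \<longleftrightarrow> head G a \<rightarrow>\<^sup>*\<^bsub>choice_subgraph G g\<^esub> r"
      if r: "r \<in> choice_roots G g" for r
    proof
      assume "i \<rightarrow>\<^sup>*\<^bsub>choice_subgraph G g\<^esub> r"
      then show "head G a \<rightarrow>\<^sup>*\<^bsub>choice_subgraph G g\<^esub> r"
      proof (cases rule: H.converse_reachable_cases)
        case base
        then show ?thesis using r \<open>g i = Some a\<close> by (simp add: choice_roots_def)
      next
        case (step w)
        then show ?thesis using \<open>g i = Some a\<close> by (auto simp: dominates_choice_subgraph[OF g])
      qed
    qed (rule H.adj_reachable_trans[OF i])
    then show ?thesis using H.adj_in_verts[OF i] unfolding S_def by simp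
  qed
  have S_root: "i \<notin> S" if "i < N" "g i = None" for i
    using that verts by (auto simp: S_def choice_roots_def intro!: bexI[of _ i])
  have row: "(\<Sum>j<N. choice_row G x (g i) i j * of_bool (j \<in> S)) = 0" if i: "i < N" for i
  proof (cases "g i")
    case None
    then show ?thesis using S_root[OF i]
      by (intro sum.neutral) (auto simp: choice_row_def)
  next
    case (Some a)
    then have "head G a < N" using arc_choices_SomeD[OF g] i verts head_in_verts by blast
    then have "(\<Sum>j<N. of_bool (i = j) * of_bool (j \<in> S)) - (\<Sum>j<N. of_bool (head G a = j) * of_bool (j \<in> S))
      = (of_bool (i \<in> S) - of_bool (head G a \<in> S) :: 'c)"
      using i by (simp add: of_bool_def if_distribR if_distrib[of "\<lambda>t. t * _"] cong: if_cong)
    then show ?thesis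
      using S_head[OF i Some] Some by (simp add: choice_row_def left_diff_distrib sum_subtractf)
  qed
  have "?M *\<^sub>v ?v = 0\<^sub>v N"
    using row by (intro eq_vecI) (auto simp: scalar_prod_def atLeast0LessThan)
  moreover have "?v \<noteq> 0\<^sub>v N"
  proof -
    obtain i where "i \<in> S" using not_forest by (auto simp: S_def rooted_forest_choice_def)
    then have "i < N" "?v $ i = 1" using verts by (auto simp: S_def)
    then show ?thesis by (metis index_zero_vec(1) zero_neq_one)
  qed
  ultimately have "\<exists>v. v \<in> carrier_vec N \<and> v \<noteq> 0\<^sub>v N \<and> ?M *\<^sub>v v = 0\<^sub>v N"
    by (intro exI[of _ ?v] conjI vec_carrier)
  then show ?thesis
    by (subst det_0_iff_vec_prod_zero_field[of _ N]) simp_all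
qed

definition laplacian_mat :: "nat \<Rightarrow> (nat, 'b) pre_digraph \<Rightarrow> 'c::comm_ring_1 mat" where
  "laplacian_mat N G = mat N N (\<lambda>(i, j). \<Sum>a\<in>out_arcs G i. of_bool (i = j) - of_bool (head G a = j))"

lemma dim_laplacian_mat:
  "dim_row (laplacian_mat N G) = N" "dim_col (laplacian_mat N G) = N"
  by (simp_all add: laplacian_mat_def)

text \<open>The determinant is multilinear in its rows, and each row of the shifted Laplacian is the sum of
  the rows belonging to the possible choices at that vertex.\<close>

theorem matrix_forest:
  fixes x :: "'c::field"
  assumes "fin_digraph G" and verts: "verts G = {..<N}"
  shows "det (x \<cdot>\<^sub>m 1\<^sub>m N + laplacian_mat N G) =
    (\<Sum>g | g \<in> arc_choices G \<and> rooted_forest_choice G g. x ^ card (choice_roots G g))"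
proof -
  interpret fin_digraph G by fact
  let ?C = "\<lambda>i. insert None (Some ` out_arcs G i)"
  let ?M = "\<lambda>g. mat N N (\<lambda>(i, j). choice_row G x (g i) i j)"
  have entry: "(x \<cdot>\<^sub>m 1\<^sub>m N + laplacian_mat N G) $$ (i, j) = (\<Sum>c\<in>?C i. choice_row G x c i j)"
    if "i < N" "j < N" for i j
    using that finite_out_arcs[of i]
    by (simp add: laplacian_mat_def choice_row_def sum.reindex)
  have "det (x \<cdot>\<^sub>m 1\<^sub>m N + laplacian_mat N G) =
      (\<Sum>\<sigma> | \<sigma> permutes {0..<N}. signof \<sigma> * (\<Prod>i = 0..<N. \<Sum>c\<in>?C i. choice_row G x c i (\<sigma> i)))"
  proof -
    have "x \<cdot>\<^sub>m 1\<^sub>m N + laplacian_mat N G \<in> carrier_mat N N" by (simp add: laplacian_mat_def)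
    then show ?thesis
      by (subst det_def'[of _ N]) (auto intro!: sum.cong prod.cong entry simp: permutes_in_image)
  qed
  also have "\<dots> = (\<Sum>\<sigma> | \<sigma> permutes {0..<N}. signof \<sigma> *
      (\<Sum>g\<in>arc_choices G. \<Prod>i = 0..<N. choice_row G x (g i) i (\<sigma> i)))"
    unfolding arc_choices_def verts lessThan_atLeast0
    by (subst prod_sum_PiE) auto
  also have "\<dots> = (\<Sum>g\<in>arc_choices G. \<Sum>\<sigma> | \<sigma> permutes {0..<N}. signof \<sigma> *
      (\<Prod>i = 0..<N. choice_row G x (g i) i (\<sigma> i)))"
    unfolding sum_distrib_left by (rule sum.swap)
  also have "\<dots> = (\<Sum>g\<in>arc_choices G. det (?M g))"
    by (intro sum.cong refl, subst det_def'[of _ N])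
      (auto intro!: sum.cong prod.cong simp: permutes_in_image)
  also have "\<dots> = (\<Sum>g\<in>arc_choices G. if rooted_forest_choice G g then x ^ card (choice_roots G g) else 0)"
    using det_choice_rooted_forest[OF assms] det_choice_not_rooted_forest[OF assms]
    by (intro sum.cong) auto
  also have "\<dots> = (\<Sum>g | g \<in> arc_choices G \<and> rooted_forest_choice G g. x ^ card (choice_roots G g))"
    using finite_arc_choices by (simp add: sum.inter_filter)
  finally show ?thesis .
qed

text \<open>Differentiating the sum over forests at \<open>0\<close> keeps exactly those with one
  root; sorting these by their root gives the sum over all roots.\<close>

theorem matrix_tree:
  assumes "fin_digraph G" and verts: "verts G = {..<N}"
  shows "((\<lambda>x :: 'c::real_normed_field. det (x \<cdot>\<^sub>m 1\<^sub>m N + laplacian_mat N G))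
    has_field_derivative of_nat (num_spanning_trees G)) (at 0)"
proof -
  interpret fin_digraph G by fact
  let ?F = "{g. g \<in> arc_choices G \<and> rooted_forest_choice G g}"
  have fin: "finite ?F" using finite_arc_choices by simp
  have "((\<lambda>x::'c. \<Sum>g\<in>?F. x ^ card (choice_roots G g)) has_field_derivative
      (\<Sum>g\<in>?F. of_nat (card (choice_roots G g)) * 0 ^ (card (choice_roots G g) - 1))) (at 0)"
    by (auto intro!: derivative_eq_intros sum.cong)
  \<comment> \<open>With one root the summand is \<open>1 * 0 ^ 0 = 1\<close>. With no root the
    truncated exponent is \<open>0\<close> as well, but the factor in front vanishes.\<close>
  also have "(\<Sum>g\<in>?F. of_nat (card (choice_roots G g)) * 0 ^ (card (choice_roots G g) - 1) :: 'c) =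
      (\<Sum>g\<in>?F. of_bool (card (choice_roots G g) = 1))"
    by (intro sum.cong) auto
  also have "\<dots> = of_nat (card {g \<in> ?F. card (choice_roots G g) = 1})"
    using fin by (simp add: Int_def)
  also have "{g \<in> ?F. card (choice_roots G g) = 1} =
      (\<Union>v\<in>verts G. {g \<in> arc_choices G. rooted_forest_choice G g \<and> choice_roots G g = {v}})"
    by (auto simp: card_1_singleton_iff choice_roots_def)
  also have "card \<dots> = num_spanning_trees G"
    unfolding num_spanning_trees_def num_arborescences_eq_card_choices
    using finite_arc_choices by (intro card_UN_disjoint) auto
  finally show ?thesis
    by (simp add: matrix_forest[OF assms])
qed

section \<open>The spectrum of a circulant digraph\<close>

definition unit_root :: "nat \<Rightarrow> nat \<Rightarrow> complex" where
  "unit_root N k = cis (2 * pi * real k / real N)"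

lemma unit_root_0 [simp]: "unit_root N 0 = 1"
  by (simp add: unit_root_def)

lemma unit_root_self [simp]: "unit_root N N = 1"
  by (cases "N = 0") (simp_all add: unit_root_def)

lemma unit_root_add: "unit_root N (a + b) = unit_root N a * unit_root N b"
  by (simp add: unit_root_def cis_mult add_divide_distrib distrib_left)

lemma unit_root_power: "unit_root N a ^ k = unit_root N (a * k)"
  by (simp add: unit_root_def DeMoivre mult_ac)

lemma unit_root_mult_self [simp]: "unit_root N (a * N) = 1"
  using unit_root_power[of N N a] by (simp add: mult.commute)

lemma unit_root_mod [simp]: "unit_root N (a mod N) = unit_root N a"
proof -
  have "unit_root N a = unit_root N (a div N * N + a mod N)"
    by simp
  then show ?thesis
    unfolding unit_root_add by simp
qed

lemma unit_root_mod_mult: "unit_root N (a mod N * b) = unit_root N (a * b)"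
  using unit_root_power[of N "a mod N" b] unit_root_power[of N a b] by simp

lemma unit_root_cancel: "m > 0 \<Longrightarrow> unit_root (N * m) (a * m) = unit_root N a"
  by (simp add: unit_root_def field_simps)

lemma unit_root_nonzero [simp]: "unit_root N a \<noteq> 0"
  by (simp add: unit_root_def)

lemma unit_root_eq_iff:
  assumes "N > 0"
  shows "unit_root N a = unit_root N b \<longleftrightarrow> [a = b] (mod N)"
proof -
  have "inj_on (unit_root N) {..<N}"
    using bij_betw_imp_inj_on[OF bij_betw_roots_unity[OF assms]] by (simp add: unit_root_def[abs_def])
  from inj_on_eq_iff[OF this, of "a mod N" "b mod N"] show ?thesis
    using assms by (simp add: cong_def)
qed

text \<open>The two exponents add up to a multiple of \<open>N\<close>, so the roots are inverse to
  each other, and on the unit circle the inverse is the conjugate.\<close>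

lemma unit_root_complement: "k \<le> N \<Longrightarrow> unit_root N ((N - k) * a) = cnj (unit_root N (k * a))"
proof -
  assume "k \<le> N"
  then have "(N - k) * a + k * a = a * N" by (simp add: flip: add_mult_distrib)
  then have "unit_root N ((N - k) * a) * unit_root N (k * a) = 1"
    by (metis unit_root_add unit_root_mult_self)
  moreover have "cnj (unit_root N (k * a)) * unit_root N (k * a) = 1"
    by (simp add: unit_root_def cis_cnj cis_mult)
  ultimately show ?thesis by (metis mult_right_cancel unit_root_nonzero)
qed

section \<open>Diagonalisation by the Fourier matrix\<close>

text \<open>By orthogonality of characters, the product with the conjugate matrix is
  \<open>N\<close> times the identity. This allows the Fourier matrix to be cancelled from an
  identity of determinants.\<close>

lemma det_fourier_nonzero:
  "det (mat N N (\<lambda>(j, k). unit_root N (j * k))) \<noteq> 0"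
proof (cases "N = 0")
  case True
  then show ?thesis by (simp add: det_def)
next
  case False
  then have N: "N > 0" by simp
  let ?F = "mat N N (\<lambda>(j, k). unit_root N (j * k))"
  let ?G = "mat N N (\<lambda>(j, k). cnj (unit_root N (j * k)))"
  have orth: "(\<Sum>j<N. unit_root N (i * j) * cnj (unit_root N (j * k))) = (if i = k then of_nat N else 0)"
    if "i < N" "k < N" for i k
  proof -
    define z where "z = unit_root N i * cnj (unit_root N k)"
    have "(\<Sum>j<N. unit_root N (i * j) * cnj (unit_root N (j * k))) = (\<Sum>j<N. z ^ j)"
      by (simp add: z_def power_mult_distrib unit_root_power mult.commute flip: complex_cnj_power)
    moreover have "z ^ N = 1"
      by (simp add: z_def power_mult_distrib unit_root_power flip: complex_cnj_power)
    moreover have "z = 1 \<longleftrightarrow> i = k"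
    proof -
      have "unit_root N k * cnj (unit_root N k) = 1"
        by (simp add: unit_root_def cis_cnj cis_mult)
      then have "z = 1 \<longleftrightarrow> unit_root N i = unit_root N k"
        unfolding z_def by (metis mult.commute mult.left_commute mult.right_neutral)
      also have "\<dots> \<longleftrightarrow> i = k"
        using that N by (simp add: unit_root_eq_iff cong_def)
      finally show ?thesis .
    qed
    ultimately show ?thesis by (simp add: sum_gp_strict)
  qed
  have "?F * ?G = of_nat N \<cdot>\<^sub>m 1\<^sub>m N"
    by (rule eq_matI) (use orth in \<open>simp_all add: scalar_prod_def atLeast0LessThan\<close>)
  then have "det ?F * det ?G = of_nat N ^ N"
    using det_mult[of ?F N ?G] by simp
  then show ?thesis using N by auto
qed

lemma laplacian_mat_circulant:
  assumes "i < N" "j < N"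
  shows "laplacian_mat N (circulant_digraph N gs) $$ (i, j) =
    (\<Sum>m<length gs. of_bool (i = j) - of_bool ((i + gs ! m) mod N = j))"
proof -
  let ?G = "circulant_digraph N gs"
  have "out_arcs ?G i = Pair i ` {..<length gs}"
    using assms by (auto simp: circulant_digraph_def out_arcs_def)
  then show ?thesis
    using assms by (simp add: laplacian_mat_def sum.reindex inj_on_def circulant_digraph_def)
qed

text \<open>Column \<open>k\<close> of the Fourier matrix \<open>?F\<close> is an eigenvector of
  \<open>M\<close> with eigenvalue \<open>ev k\<close>. Taking determinants in
  \<open>M * ?F = ?F * mat_diag N ev\<close> and cancelling \<open>det ?F\<close> avoids an explicit
  inverse.\<close>

lemma det_circulant:
  fixes x :: complex
  shows "det (x \<cdot>\<^sub>m 1\<^sub>m N + laplacian_mat N (circulant_digraph N gs)) =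
    (\<Prod>k<N. x + (\<Sum>m<length gs. 1 - unit_root N (gs ! m * k)))"
proof -
  define M where "M = x \<cdot>\<^sub>m 1\<^sub>m N + laplacian_mat N (circulant_digraph N gs)"
  let ?F = "mat N N (\<lambda>(j, k). unit_root N (j * k))"
  define ev where "ev k = x + (\<Sum>m<length gs. 1 - unit_root N (gs ! m * k))" for k
  have M: "M \<in> carrier_mat N N" by (simp add: M_def laplacian_mat_def)
  have entry: "(\<Sum>j<N. M $$ (i, j) * unit_root N (j * k)) = unit_root N (i * k) * ev k"
    if i: "i < N" and k: "k < N" for i k
  proof -
    have delta: "(\<Sum>j<N. of_bool (l = j) * unit_root N (j * k)) = unit_root N (l * k)" if "l < N" for l
    proof -
      have "(\<Sum>j<N. of_bool (l = j) * unit_root N (j * k)) = (\<Sum>j<N. if l = j then unit_root N (j * k) else 0)"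
        by (intro sum.cong) auto
      then show ?thesis using that by simp
    qed
    have "(\<Sum>j<N. M $$ (i, j) * unit_root N (j * k)) =
      (\<Sum>j<N. x * (of_bool (i = j) * unit_root N (j * k)) + (\<Sum>m<length gs.
         of_bool (i = j) * unit_root N (j * k) - of_bool ((i + gs ! m) mod N = j) * unit_root N (j * k)))"
      using i by (intro sum.cong refl)
        (simp add: M_def laplacian_mat_circulant dim_laplacian_mat distrib_right sum_distrib_right left_diff_distrib)
    also have "\<dots> = x * unit_root N (i * k) + (\<Sum>m<length gs.
         unit_root N (i * k) - unit_root N ((i + gs ! m) mod N * k))"
    proof -
      have "(i + gs ! m) mod N < N" for m using i by simp
      then show ?thesis
        by (simp only: sum.distrib sum.swap[where A = "{..<N}" and B = "{..<length gs}"] sum_subtractf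
            delta[OF i] delta sum_distrib_left[where r = x, symmetric])
    qed
    \<comment> \<open>A reduction modulo \<open>N\<close> is invisible to the character, so moving
      along a generator just multiplies by the value of the character there.\<close>
    also have "\<dots> = unit_root N (i * k) * ev k"
      by (simp add: ev_def unit_root_mod_mult add_mult_distrib unit_root_add sum_distrib_left
          right_diff_distrib distrib_left mult.commute[of x])
    finally show ?thesis .
  qed
  have "M * ?F = ?F * mat_diag N ev"
    using M entry
    by (subst mat_diag_mult_right[of _ N N])
      (auto intro!: eq_matI simp: scalar_prod_def atLeast0LessThan carrier_matD)
  then have "det M * det ?F = det ?F * det (mat_diag N ev)"
    by (metis det_mult[OF M mat_carrier] det_mult[OF mat_carrier mat_diag_dim])
  moreover have "det (mat_diag N ev) = (\<Prod>k<N. ev k)"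
    by (subst det_upper_triangular[of _ N])
      (auto simp: mat_diag_def diag_mat_def atLeast0LessThan prod.distinct_set_conv_list[symmetric]
        intro!: upper_triangularI)
  ultimately show ?thesis
    using det_fourier_nonzero[of N] by (simp add: ev_def M_def mult.commute)
qed

section \<open>Products over roots of unity\<close>

text \<open>The factorisation of \<open>X ^ n - 1\<close>, evaluated at \<open>y / c\<close> and
  scaled by \<open>c ^ n\<close>. The case \<open>c = 0\<close> is treated apart; it does occur
  later, when \<open>1 + unit_root \<beta> (k * \<gamma>)\<close> vanishes.\<close>

lemma prod_diff_roots_unity:
  assumes "n > 0"
  shows "(\<Prod>z | z ^ n = 1. y - c * z) = y ^ n - (c::complex) ^ n"
proof (cases "c = 0")
  case True
  then show ?thesis using assms by (simp add: card_roots_unity_eq)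
next
  case False
  let ?p = "monom 1 n - 1 :: complex poly"
  have deg: "degree ?p = n" "lead_coeff ?p = 1"
  proof -
    show "degree ?p = n"
      using assms degree_add_eq_left[of "-1" "monom (1 :: complex) n"] by (simp add: degree_monom_eq)
    then show "lead_coeff ?p = 1" using assms by simp
  qed
  \<comment> \<open>The derivative vanishes at most at \<open>0\<close>, which is not a root, so all
    roots are simple and a product over the set of roots gives the whole polynomial.\<close>
  have "poly (pderiv ?p) z \<noteq> 0" if "poly ?p z = 0" for z
    using that assms by (auto simp: poly_monom pderiv_diff pderiv_monom power_0_left split: if_splits)
  then have "rsquarefree ?p" by (auto simp: rsquarefree_roots)
  then have "smult (lead_coeff ?p) (\<Prod>z | poly ?p z = 0. [:- z, 1:]) = ?p"
    by (rule complex_poly_decompose_rsquarefree)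
  then have "(\<Prod>z | z ^ n = 1. [:- z, 1:]) = ?p"
    unfolding deg(2) by (simp add: poly_monom)
  then have "poly (\<Prod>z | z ^ n = 1. [:- z, 1:]) (y / c) = (y / c) ^ n - 1"
    by (simp add: poly_monom)
  then have "c ^ n * (\<Prod>z | z ^ n = 1. y / c - z) = y ^ n - c ^ n"
    using False by (simp add: poly_prod power_divide right_diff_distrib)
  also have "c ^ n * (\<Prod>z | z ^ n = 1. y / c - z) = (\<Prod>z | z ^ n = 1. c * (y / c - z))"
    using card_roots_unity_eq[OF assms] by (simp add: prod.distrib)
  finally show ?thesis using False by (simp add: right_diff_distrib)
qed

text \<open>Multiplication by \<open>p\<close> is injective modulo \<open>n\<close>, so the
  \<open>n\<close> values \<open>unit_root n (p * l)\<close> exhaust the \<open>n\<close>-th roots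
  of unity. This is where coprimality enters.\<close>

lemma prod_diff_unit_root:
  assumes "n > 0" and "coprime p n"
  shows "(\<Prod>l<n. y - c * unit_root n (p * l)) = y ^ n - c ^ n"
proof -
  have inj: "inj_on (\<lambda>l. unit_root n (p * l)) {..<n}"
  proof (rule inj_onI)
    fix a b assume "a \<in> {..<n}" "b \<in> {..<n}" "unit_root n (p * a) = unit_root n (p * b)"
    then show "a = b"
      using assms by (simp add: unit_root_eq_iff cong_mult_lcancel_nat cong_less_modulus_unique_nat)
  qed
  have "(\<lambda>l. unit_root n (p * l)) ` {..<n} = {z. z ^ n = 1}"
    using assms(1) card_image[OF inj]
    by (intro card_subset_eq)
      (auto simp: finite_roots_unity card_roots_unity_eq unit_root_power)
  then have "(\<Prod>l<n. y - c * unit_root n (p * l)) = (\<Prod>z | z ^ n = 1. y - c * z)"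
    using prod.reindex[OF inj, of "\<lambda>z. y - c * z"] by simp
  then show ?thesis using prod_diff_roots_unity[OF assms(1)] by simp
qed

text \<open>Division with remainder by \<open>b\<close>: the remainder becomes the outer index, the
  quotient the inner one.\<close>

lemma prod_lessThan_mult:
  fixes f :: "nat \<Rightarrow> 'a::comm_monoid_mult"
  shows "(\<Prod>j<b * n. f j) = (\<Prod>k<b. \<Prod>l<n. f (k + b * l))"
proof (cases "b = 0")
  case False
  have "k + b * l < b * n" if "k < b" "l < n" for k l
  proof -
    have "k + b * l < b * Suc l" using that by simp
    also have "\<dots> \<le> b * n" using that by (intro mult_le_mono) auto
    finally show ?thesis .
  qed
  then have "(\<Prod>j<b * n. f j) = (\<Prod>(k, l)\<in>{..<b} \<times> {..<n}. f (k + b * l))"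
    using False
    by (intro prod.reindex_bij_witness[of _ "\<lambda>(k, l). k + b * l" "\<lambda>j. (j mod b, j div b)"])
      (auto simp: less_mult_imp_div_less mult.commute)
  then show ?thesis by (simp add: prod.cartesian_product)
qed simp

section \<open>Two generators differing by a multiple of \<open>n\<close>\<close>

text \<open>In Caratheodory's form \<open>u z - u a = g z * (z - a)\<close>, multiplying by
  \<open>v z\<close> gives the new slope function \<open>g z * v z\<close>. Thus only the vanishing
  factor of a product is ever differentiated.\<close>

lemma DERIV_mult_zero_factor:
  fixes u v :: "'a::real_normed_field \<Rightarrow> 'a"
  assumes "(u has_field_derivative u') (at a)" and "u a = 0" and "isCont v a"
  shows "((\<lambda>x. u x * v x) has_field_derivative u' * v a) (at a)"
proof -
  obtain g where g: "\<And>z. u z - u a = g z * (z - a)" "isCont g a" "g a = u'"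
    using assms(1) by (auto simp: CARAT_DERIV)
  have "u z * v z - u a * v a = (g z * v z) * (z - a)" for z
  proof -
    have "u z * v z - u a * v a = (u z - u a) * v z" using assms(2) by simp
    then show ?thesis unfolding g(1) by (simp add: mult_ac)
  qed
  with g(2,3) assms(3) show ?thesis
    by (auto simp: CARAT_DERIV intro!: exI[of _ "\<lambda>z. g z * v z"] continuous_intros)
qed

lemma num_spanning_trees_DERIV:
  "((\<lambda>x::complex. \<Prod>k<N. x + (\<Sum>m<length gs. 1 - unit_root N (gs ! m * k)))
     has_field_derivative of_nat (num_spanning_trees (circulant_digraph N gs))) (at 0)"
proof -
  have "verts (circulant_digraph N gs) = {..<N}" by (simp add: circulant_digraph_def)
  from matrix_tree[where 'c = complex, OF fin_digraph_circulant_digraph this]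
  show ?thesis by (simp only: det_circulant)
qed

text \<open>The character \<open>0\<close> always contributes the factor \<open>x\<close>. The
  character \<open>j\<close> is trivial on all generators, so it contributes a second
  \<open>x\<close>, and the product has a double zero.\<close>

lemma num_spanning_trees_eq_0:
  assumes "0 < j" "j < N" and "\<And>m. m < length gs \<Longrightarrow> N dvd gs ! m * j"
  shows "num_spanning_trees (circulant_digraph N gs) = 0"
proof -
  let ?f = "\<lambda>k (x::complex). x + (\<Sum>m<length gs. 1 - unit_root N (gs ! m * k))"
  have j: "?f j = (\<lambda>x. x)"
  proof -
    have "unit_root N (gs ! m * j) = 1" if "m < length gs" for m
      using assms(3)[OF that] by (auto simp: mult.commute elim!: dvdE)
    then show ?thesis by simp
  qed
  have "(\<lambda>x. \<Prod>k<N. ?f k x) = (\<lambda>x. x * (x * (\<Prod>k\<in>{..<N} - {0} - {j}. ?f k x)))"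
  proof
    fix x
    have "(\<Prod>k<N. ?f k x) = ?f 0 x * (?f j x * (\<Prod>k\<in>{..<N} - {0} - {j}. ?f k x))"
      using assms(1,2) by (simp add: prod.remove[of "{..<N}" 0] prod.remove[of "{..<N} - {0}" j])
    then show "(\<Prod>k<N. ?f k x) = x * (x * (\<Prod>k\<in>{..<N} - {0} - {j}. ?f k x))"
      using fun_cong[OF j] by simp
  qed
  moreover have "((\<lambda>x. x * (x * (\<Prod>k\<in>{..<N} - {0} - {j}. ?f k x))) has_field_derivative
      1 * (0 * (\<Prod>k\<in>{..<N} - {0} - {j}. ?f k 0))) (at 0)"
    by (intro DERIV_mult_zero_factor) (auto intro!: continuous_intros)
  ultimately have "of_nat (num_spanning_trees (circulant_digraph N gs)) = (0::complex)"
    using DERIV_unique[OF num_spanning_trees_DERIV[of N gs]] by simp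
  then show ?thesis by simp
qed

lemma num_spanning_trees_coprime:
  assumes "\<beta> > 0" and "n > 0" and "coprime p n"
  shows "of_nat (num_spanning_trees (circulant_digraph (\<beta> * n) [p, \<gamma> * n + p])) =
    of_nat n * 2 ^ (n - 1) *
    (\<Prod>k = 1..<\<beta>. 2 ^ n - unit_root \<beta> (k * p) * (1 + unit_root \<beta> (k * \<gamma>)) ^ n)"
proof -
  \<comment> \<open>\<open>c k\<close> is the part of the eigenvalue that does not depend on
    \<open>l\<close>. It involves a root of order \<open>\<beta> * n\<close>, but its power
    \<open>b k = c k ^ n\<close> needs only roots of order \<open>\<beta>\<close>.\<close>
  define c where "c k = unit_root (\<beta> * n) (k * p) * (1 + unit_root \<beta> (k * \<gamma>))" for k
  define b where "b k = unit_root \<beta> (k * p) * (1 + unit_root \<beta> (k * \<gamma>)) ^ n" for k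
  let ?N = "\<beta> * n" and ?gs = "[p, \<gamma> * n + p]"
  have factor: "x + (\<Sum>m<length ?gs. 1 - unit_root ?N (?gs ! m * (k + \<beta> * l))) =
      (x + 2) - c k * unit_root n (p * l)" for x :: complex and k l
  proof -
    have "unit_root ?N (p * (k + \<beta> * l)) = unit_root ?N (k * p) * unit_root n (p * l)"
      using unit_root_cancel[OF assms(1), of n "p * l"]
      by (simp add: unit_root_add distrib_left mult_ac)
    moreover have "unit_root ?N (\<gamma> * n * (k + \<beta> * l)) = unit_root \<beta> (k * \<gamma>)"
    proof -
      have "unit_root ?N (\<gamma> * n * (k + \<beta> * l)) = unit_root \<beta> (\<gamma> * (k + \<beta> * l))"
        using unit_root_cancel[OF assms(2), of \<beta> "\<gamma> * (k + \<beta> * l)"] by (simp add: mult_ac)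
      also have "\<dots> = unit_root \<beta> (k * \<gamma>) * unit_root \<beta> (\<gamma> * l * \<beta>)"
        by (simp add: distrib_left mult_ac flip: unit_root_add)
      finally show ?thesis by simp
    qed
    ultimately show ?thesis
      by (simp add: numeral_2_eq_2 c_def add_mult_distrib unit_root_add algebra_simps)
  qed
  have c_power: "c k ^ n = b k" for k
    using unit_root_cancel[OF assms(2), of \<beta> "k * p"]
    by (simp add: c_def b_def power_mult_distrib unit_root_power)
  have b0: "b 0 = 2 ^ n" by (simp add: b_def)
  have "(\<Prod>j<?N. x + (\<Sum>m<length ?gs. 1 - unit_root ?N (?gs ! m * j))) =
      ((x + 2) ^ n - 2 ^ n) * (\<Prod>k = 1..<\<beta>. (x + 2) ^ n - b k)" for x
  proof -
    have "(\<Prod>j<?N. x + (\<Sum>m<length ?gs. 1 - unit_root ?N (?gs ! m * j))) =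
        (\<Prod>k<\<beta>. (x + 2) ^ n - c k ^ n)"
      unfolding prod_lessThan_mult factor by (simp only: prod_diff_unit_root[OF assms(2,3)])
    also have "{..<\<beta>} = insert 0 {1..<\<beta>}" using assms(1) by auto
    finally show ?thesis by (simp add: c_power b0)
  qed
  \<comment> \<open>Only the factor for \<open>k = 0\<close> is differentiated; its derivative at
    \<open>0\<close> is \<open>n * 2 ^ (n - 1)\<close>.\<close>
  moreover have "((\<lambda>x. ((x + 2) ^ n - 2 ^ n) * (\<Prod>k = 1..<\<beta>. (x + 2) ^ n - b k)) has_field_derivative
      of_nat n * 2 ^ (n - 1) * (\<Prod>k = 1..<\<beta>. (0 + 2) ^ n - b k)) (at 0)"
    by (intro DERIV_mult_zero_factor) (auto intro!: derivative_eq_intros continuous_intros)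
  ultimately show ?thesis
    using DERIV_unique[OF num_spanning_trees_DERIV[of ?N ?gs]] by (simp add: b_def)
qed

section \<open>Pairing conjugate factors\<close>

text \<open>Taking out the half-angle phase is the source both of the cosine powers in the result
  and of the shift \<open>\<gamma> * n / 2\<close> in its phase.\<close>

lemma one_plus_cis: "1 + cis t = of_real (2 * cos (t / 2)) * cis (t / 2)"
proof -
  have "cis t = cis (t / 2) * cis (t / 2)" "cis (t / 2) * cis (- (t / 2)) = 1"
    by (simp_all add: cis_mult)
  moreover have "of_real (2 * cos (t / 2)) = cis (t / 2) + cis (- (t / 2))"
    by (simp add: complex_eq_iff)
  ultimately show ?thesis by (simp add: distrib_left mult.commute[of "_ + _"])
qed

text \<open>In polar form \<open>b\<close> is \<open>2 ^ n * C * cis t\<close> with \<open>C\<close>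
  and \<open>t\<close> real, so this is \<open>4 ^ n\<close> times the squared modulus of
  \<open>1 - C * cis t\<close>.\<close>

lemma norm_factor:
  fixes \<beta> \<gamma> p n k :: nat
  defines "b \<equiv> unit_root \<beta> (k * p) * (1 + unit_root \<beta> (k * \<gamma>)) ^ n"
  shows "(2 ^ n - b) * cnj (2 ^ n - b) = of_real (2 ^ (2 * n) *
    (1 - 2 * cos (2 * pi * (real p + real \<gamma> * real n / 2) * real k / real \<beta>)
           * cos (pi * real \<gamma> * real k / real \<beta>) ^ n
       + cos (pi * real \<gamma> * real k / real \<beta>) ^ (2 * n)))"
proof -
  define C where "C = cos (pi * real \<gamma> * real k / real \<beta>) ^ n"
  define t where "t = 2 * pi * (real p + real \<gamma> * real n / 2) * real k / real \<beta>"
  have "1 + unit_root \<beta> (k * \<gamma>) =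
      of_real (2 * cos (pi * real \<gamma> * real k / real \<beta>)) * cis (pi * real \<gamma> * real k / real \<beta>)"
    using one_plus_cis[of "2 * pi * real (k * \<gamma>) / real \<beta>"] by (simp add: unit_root_def mult_ac)
  then have "b = of_real (2 ^ n * C) * (unit_root \<beta> (k * p) * cis (real n * (pi * real \<gamma> * real k / real \<beta>)))"
    by (simp add: b_def power_mult_distrib DeMoivre C_def)
  also have "unit_root \<beta> (k * p) * cis (real n * (pi * real \<gamma> * real k / real \<beta>)) = cis t"
  proof -
    have "2 * pi * real (k * p) / real \<beta> + real n * (pi * real \<gamma> * real k / real \<beta>) = t"
      \<comment> \<open>Clearing denominators needs \<open>\<beta>\<close> nonzero; for
        \<open>\<beta> = 0\<close> both sides are \<open>0\<close> by the convention on
        division.\<close>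
      by (cases "\<beta> = 0") (simp_all add: t_def field_simps)
    then show ?thesis by (simp add: unit_root_def cis_mult)
  qed
  finally have b: "2 ^ n - b = of_real (2 ^ n) * (1 - of_real C * cis t)"
    by (simp add: algebra_simps)
  have "(1 - of_real C * cis t) * cnj (1 - of_real C * cis t) = of_real (1 - 2 * cos t * C + C\<^sup>2)"
  proof -
    have "(1 - C * cos t)\<^sup>2 + (C * sin t)\<^sup>2 = 1 - 2 * cos t * C + C\<^sup>2 * ((cos t)\<^sup>2 + (sin t)\<^sup>2)"
      unfolding power2_eq_square by (simp only: algebra_simps)
    also have "\<dots> = 1 - 2 * cos t * C + C\<^sup>2" by simp
    finally have "(Re (1 - of_real C * cis t))\<^sup>2 + (Im (1 - of_real C * cis t))\<^sup>2 =
        1 - 2 * cos t * C + C\<^sup>2" by simp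
    then show ?thesis by (simp only: complex_mult_cnj)
  qed
  moreover have "(of_real r * w) * cnj (of_real r * w) = of_real (r * r) * (w * cnj w)" for r w
    by simp
  ultimately have "(2 ^ n - b) * cnj (2 ^ n - b) = of_real (2 ^ n * 2 ^ n) * of_real (1 - 2 * cos t * C + C\<^sup>2)"
    unfolding b by (simp only:)
  also have "\<dots> = of_real (2 ^ (2 * n) * (1 - 2 * cos t * C + C\<^sup>2))"
    by (simp only: of_real_mult mult_2 power_add)
  also have "C\<^sup>2 = cos (pi * real \<gamma> * real k / real \<beta>) ^ (2 * n)"
    by (simp add: C_def mult.commute flip: power_mult)
  finally show ?thesis unfolding C_def t_def .
qed

text \<open>The reflection of \<open>k\<close> to \<open>\<beta> - k\<close> exchanges the two
  blocks and conjugates \<open>h\<close>. The length \<open>m\<close> is left open because the odd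
  and the even case use \<open>(\<beta> - 1) / 2\<close> and \<open>\<beta> / 2 - 1\<close>.\<close>

lemma prod_norm_factor:
  fixes \<beta> \<gamma> p n m :: nat
  defines "h \<equiv> \<lambda>k. 2 ^ n - unit_root \<beta> (k * p) * (1 + unit_root \<beta> (k * \<gamma>)) ^ n"
  assumes "m \<le> \<beta>"
  shows "(\<Prod>k = 1..m. h k) * (\<Prod>k = \<beta> - m..<\<beta>. h k) = of_real (2 ^ (2 * n * m) *
    (\<Prod>k = 1..m. 1 - 2 * cos (2 * pi * (real p + real \<gamma> * real n / 2) * real k / real \<beta>)
           * cos (pi * real \<gamma> * real k / real \<beta>) ^ n
       + cos (pi * real \<gamma> * real k / real \<beta>) ^ (2 * n)))"
proof -
  have "(\<Prod>k = \<beta> - m..<\<beta>. h k) = (\<Prod>k = 1..m. h (\<beta> - k))"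
    using assms(2)
    by (intro prod.reindex_bij_witness[of _ "\<lambda>k. \<beta> - k" "\<lambda>k. \<beta> - k"]) auto
  also have "\<dots> = (\<Prod>k = 1..m. cnj (h k))"
    using assms(2) by (intro prod.cong refl) (simp add: h_def unit_root_complement)
  finally have "(\<Prod>k = 1..m. h k) * (\<Prod>k = \<beta> - m..<\<beta>. h k) = (\<Prod>k = 1..m. h k * cnj (h k))"
    by (simp add: prod.distrib)
  then show ?thesis
    unfolding h_def norm_factor by (simp add: prod.distrib flip: power_mult)
qed

lemma unit_root_double_half: "m > 0 \<Longrightarrow> unit_root (2 * m) (m * a) = (- 1) ^ a"
proof -
  assume "m > 0"
  then have "unit_root (2 * m) m = - 1" by (simp add: unit_root_def)
  then show ?thesis by (simp flip: unit_root_power)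
qed

section \<open>The cases of the theorem\<close>

text \<open>For odd \<open>\<beta>\<close> no index is fixed by the reflection, so all factors for
  \<open>k\<close> in \<open>{1..<\<beta>}\<close> pair up.\<close>

lemma num_spanning_trees_odd:
  fixes \<beta> \<gamma> p n :: nat
  assumes "n > 0" and "odd \<beta>" and "coprime p n"
  shows "real (num_spanning_trees (circulant_digraph (\<beta> * n) [p, \<gamma> * n + p])) =
    real n * 2 ^ (\<beta> * n - 1) *
    (\<Prod>k = 1..(\<beta> - 1) div 2.
       1 - 2 * cos (2 * pi * (real p + real \<gamma> * real n / 2) * real k / real \<beta>)
             * cos (pi * real \<gamma> * real k / real \<beta>) ^ n
         + cos (pi * real \<gamma> * real k / real \<beta>) ^ (2 * n))"
    (is "real ?T = _ * _ * ?P")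
proof -
  obtain m where m: "\<beta> = 2 * m + 1" using assms(2) by (rule oddE)
  have m': "(\<beta> - 1) div 2 = m" and "m \<le> \<beta>" and "\<beta> > 0" using m by simp_all
  let ?h = "\<lambda>k. 2 ^ n - unit_root \<beta> (k * p) * (1 + unit_root \<beta> (k * \<gamma>)) ^ n"
  have split: "{1..<\<beta>} = {1..m} \<union> {\<beta> - m..<\<beta>}" and disj: "{1..m} \<inter> {\<beta> - m..<\<beta>} = {}"
    using m by auto
  have "(\<Prod>k = 1..<\<beta>. ?h k) = (\<Prod>k = 1..m. ?h k) * (\<Prod>k = \<beta> - m..<\<beta>. ?h k)"
    unfolding split using disj by (intro prod.union_disjoint) simp_all
  also have "\<dots> = of_real (2 ^ (2 * n * m) * ?P)"
    unfolding m' by (rule prod_norm_factor) fact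
  finally have "complex_of_real (real ?T) = of_real (real n * 2 ^ (n - 1) * (2 ^ (2 * n * m) * ?P))"
    using num_spanning_trees_coprime[OF \<open>\<beta> > 0\<close> assms(1,3), of \<gamma>] by simp
  then have "real ?T = real n * (2 ^ (n - 1) * 2 ^ (2 * n * m)) * ?P"
    unfolding of_real_eq_iff by (simp only: mult_ac)
  also have "2 ^ (n - 1) * 2 ^ (2 * n * m) = (2 ^ (\<beta> * n - 1) :: real)"
  proof -
    \<comment> \<open>The derivative supplies \<open>n - 1\<close> factors \<open>2\<close>, and
      each of the \<open>m\<close> pairs supplies \<open>2 * n\<close>.\<close>
    have "n - 1 + 2 * n * m = \<beta> * n - 1" using m assms(1) by (simp add: algebra_simps)
    then show ?thesis by (simp flip: power_add)
  qed
  finally show ?thesis .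
qed

lemma num_spanning_trees_even:
  fixes \<beta> \<gamma> p n :: nat
  assumes "\<beta> > 0" and "n > 0" and "even \<beta>" and "coprime p n"
  shows "real (num_spanning_trees (circulant_digraph (\<beta> * n) [p, \<gamma> * n + p])) =
    (if even \<gamma> \<and> even p then 0 else
    real n * 2 ^ (\<beta> * n - 1 + of_bool (even \<gamma>)) *
    (\<Prod>k = 1..\<beta> div 2 - 1.
       1 - 2 * cos (2 * pi * (real p + real \<gamma> * real n / 2) * real k / real \<beta>)
             * cos (pi * real \<gamma> * real k / real \<beta>) ^ n
         + cos (pi * real \<gamma> * real k / real \<beta>) ^ (2 * n)))"
    (is "real ?T = (if _ then 0 else _ * _ * ?P)")
proof -
  obtain m where m: "\<beta> = 2 * m" using assms(3) by (rule evenE)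
  have m': "\<beta> div 2 - 1 = m - 1" and "m - 1 \<le> \<beta>" and "m > 0" using m assms(1) by presburger+
  let ?h = "\<lambda>k. 2 ^ n - unit_root \<beta> (k * p) * (1 + unit_root \<beta> (k * \<gamma>)) ^ n"
  \<comment> \<open>The middle factor \<open>2 ^ n - (-1) ^ p * (1 + (-1) ^ \<gamma>) ^ n\<close>:
    it is \<open>2 ^ n\<close> for odd \<gamma>, where the bracket vanishes, and for even \<gamma>
    it is \<open>2 ^ n + 2 ^ n\<close> or \<open>0\<close> according as \<open>p\<close> is odd or
    even.\<close>
  define d :: real where "d = (if even \<gamma> \<and> even p then 0 else 2 ^ (n + of_bool (even \<gamma>)))"
  have h: "?h m = of_real d"
    using assms(2) unfolding m unit_root_double_half[OF \<open>m > 0\<close>]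
    by (auto simp: d_def power_0_left)
  have split: "{1..<\<beta>} = insert m ({1..m - 1} \<union> {\<beta> - (m - 1)..<\<beta>})"
    and notin: "m \<notin> {1..m - 1} \<union> {\<beta> - (m - 1)..<\<beta>}"
    and disj: "{1..m - 1} \<inter> {\<beta> - (m - 1)..<\<beta>} = {}"
    using m \<open>m > 0\<close> by auto
  have "(\<Prod>k = 1..<\<beta>. ?h k) =
      ?h m * ((\<Prod>k = 1..m - 1. ?h k) * (\<Prod>k = \<beta> - (m - 1)..<\<beta>. ?h k))"
    unfolding split
    using prod.insert[OF _ notin, where g = ?h] prod.union_disjoint[OF _ _ disj, where g = ?h]
    by (simp only: finite_Un finite_atLeastAtMost finite_atLeastLessThan)
  also have "(\<Prod>k = 1..m - 1. ?h k) * (\<Prod>k = \<beta> - (m - 1)..<\<beta>. ?h k) = of_real (2 ^ (2 * n * (m - 1)) * ?P)"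
    unfolding m' by (rule prod_norm_factor) fact
  finally have "complex_of_real (real ?T) = of_real (real n * 2 ^ (n - 1) * (d * (2 ^ (2 * n * (m - 1)) * ?P)))"
    using num_spanning_trees_coprime[OF assms(1,2,4), of \<gamma>] h by simp
  then have T: "real ?T = real n * (2 ^ (n - 1) * d * 2 ^ (2 * n * (m - 1))) * ?P"
    unfolding of_real_eq_iff by (simp only: mult_ac)
  show ?thesis
  proof (cases "even \<gamma> \<and> even p")
    case True
    then show ?thesis using T by (simp add: d_def)
  next
    case False
    \<comment> \<open>The exponents of \<open>2\<close> come from the derivative, the middle factor
      and the \<open>m - 1\<close> pairs.\<close>
    have "n - 1 + (n + of_bool (even \<gamma>)) + 2 * n * (m - 1) = \<beta> * n - 1 + of_bool (even \<gamma>)"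
    proof -
      have "m * n \<ge> n" using \<open>m > 0\<close> by simp
      moreover have "2 * n * (m - 1) = 2 * (m * n) - 2 * n" by (simp add: diff_mult_distrib2 mult_ac)
      moreover have "\<beta> * n = 2 * (m * n)" using m by simp
      ultimately show ?thesis using assms(2) by linarith
    qed
    then have "2 ^ (n - 1) * d * 2 ^ (2 * n * (m - 1)) = 2 ^ (\<beta> * n - 1 + of_bool (even \<gamma>))"
      using False by (simp only: d_def if_False flip: power_add)
    then show ?thesis using T False by (simp only: if_False)
  qed
qed

text \<open>With \<open>d = gcd p n\<close>, the character \<open>\<beta> * (n / d)\<close> is
  trivial on both generators, and it lies strictly between \<open>0\<close> and
  \<open>\<beta> * n\<close> because \<open>d > 1\<close>.\<close>

lemma num_spanning_trees_not_coprime: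
  fixes \<beta> \<gamma> p n :: nat
  assumes "\<beta> > 0" and "n > 0" and "gcd p n \<noteq> 1"
  shows "num_spanning_trees (circulant_digraph (\<beta> * n) [p, \<gamma> * n + p]) = 0"
proof -
  define d where "d = gcd p n"
  obtain n' p' where n': "n = d * n'" and p': "p = d * p'"
    unfolding d_def by (meson dvdE gcd_dvd1 gcd_dvd2)
  have "d \<noteq> 1" using assms(3) by (simp add: d_def)
  moreover have "d > 0" "n' > 0" using assms(2) by (simp_all add: n')
  ultimately have "d > 1" by simp
  have "\<beta> * n dvd [p, \<gamma> * n + p] ! m * (\<beta> * n')" if "m < length [p, \<gamma> * n + p]" for m
  proof -
    have "p * (\<beta> * n') = \<beta> * n * p'" "\<gamma> * n * (\<beta> * n') = \<beta> * n * (\<gamma> * n')"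
      by (simp_all add: n' p')
    then have "\<beta> * n dvd p * (\<beta> * n')" "\<beta> * n dvd \<gamma> * n * (\<beta> * n')"
      by (metis dvd_triv_left)+
    then have "\<beta> * n dvd a * (\<beta> * n')" if "a \<in> {p, \<gamma> * n + p}" for a
      using that by (auto simp only: add_mult_distrib dvd_add insert_iff empty_iff)
    moreover have "[p, \<gamma> * n + p] ! m \<in> {p, \<gamma> * n + p}"
      using nth_mem[OF that] by simp
    ultimately show ?thesis by blast
  qed
  moreover have "0 < \<beta> * n'" "\<beta> * n' < \<beta> * n"
    using assms(1) \<open>d > 1\<close> \<open>n' > 0\<close> by (simp_all add: n')
  ultimately show ?thesis
    by (intro num_spanning_trees_eq_0)
qed

theorem theorem2p2:
  fixes \<beta> \<gamma> p n :: nat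
  assumes "\<beta> > 0" and "\<gamma> > 0" and "p > 0" and "n > 0" and "1 \<le> \<gamma>" and "\<gamma> \<le> \<beta>"
  shows
    "(odd \<beta> \<and> gcd p n = 1 \<longrightarrow>
       real (num_spanning_trees (circulant_digraph (\<beta> * n) [p, \<gamma> * n + p])) =
       real n * 2 ^ (\<beta> * n - 1) *
       (\<Prod>k = 1..(\<beta> - 1) div 2.
          1 - 2 * cos (2 * pi * (real p + real \<gamma> * real n / 2) * real k / real \<beta>)
                * cos (pi * real \<gamma> * real k / real \<beta>) ^ n
            + cos (pi * real \<gamma> * real k / real \<beta>) ^ (2 * n))) \<and>
     (even \<beta> \<and> gcd p n = 1 \<and> (odd \<gamma> \<or> odd p) \<longrightarrow>
       real (num_spanning_trees (circulant_digraph (\<beta> * n) [p, \<gamma> * n + p])) =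
       real n * 2 ^ (\<beta> * n - 1 + of_bool (even \<gamma>)) *
       (\<Prod>k = 1..\<beta> div 2 - 1.
          1 - 2 * cos (2 * pi * (real p + real \<gamma> * real n / 2) * real k / real \<beta>)
                * cos (pi * real \<gamma> * real k / real \<beta>) ^ n
            + cos (pi * real \<gamma> * real k / real \<beta>) ^ (2 * n))) \<and>
     ((gcd p n = 1 \<and> even \<beta> \<and> even p \<and> even \<gamma>) \<or> gcd p n \<noteq> 1 \<longrightarrow>
       num_spanning_trees (circulant_digraph (\<beta> * n) [p, \<gamma> * n + p]) = 0)"
  using assms num_spanning_trees_odd[of n \<beta> p \<gamma>] num_spanning_trees_even[of \<beta> n p \<gamma>]
    num_spanning_trees_not_coprime[of \<beta> n p \<gamma>]
  by (auto simp: coprime_iff_gcd_eq_1)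

end
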